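(* Let $\mathcal{G}=(\mathcal{N},\mathcal{X}=\prod_{i=1}^N\mathbb{R}^{n_i},\{u_i\}_{i=1}^N)$ be a $\lambda$-cocoercive continuous game ($\lambda>0$) whose set of Nash equilibria $\mathcal{X}^*$ is nonempty. Let $(\mathbf{x}_t)_{t\ge0}$ be the noisy online gradient descent iterates $\mathbf{x}_{t+1}=\mathbf{x}_t+\eta_{t+1}(\mathbf{v}(\mathbf{x}_t)+\xi_{t+1})$ with relative random noise, i.e. $\mathbb{E}[\xi_{t+1}\mid\mathcal{F}_t]=0$ and $\mathbb{E}[\|\xi_{t+1}\|^2\mid\mathcal{F}_t]\le\tau_t\|\mathbf{v}(\mathbf{x}_t)\|^2$ for all $t\ge0$, where $\tau_t\in(0,\tau]$ for some $\tau<+\infty$. Suppose that $\{\tau_t\}_{t\ge0}$ is nonincreasing and that there is a function $a:\mathbb{R}^+\to\mathbb{R}^+$ with $a(t)=o(1)$ such that $$\frac{1}{T+1}\left(\sum_{t=0}^{T-1}\tau_t\right)=O(a(T)).$$ Suppose the step-size sequence satisfies $0<\underline{\eta}\le\eta_t\le\overline{\eta}<\lambda/(1+\tau)$ for all $t\ge1$. Then, as $T\to\infty$, $$\mathbb{E}[\epsilon(\mathbf{x}_T)]=\begin{cases}O(a(T)) & \text{if } a(T)=\Omega(1/T),\\ O(1/T) & \text{otherwise.}\end{cases}$$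
   Context: A continuous game $\mathcal{G}=(\mathcal{N},\mathcal{X}=\prod_{i=1}^N\mathcal{X}_i,\{u_i\}_{i=1}^N)$ consists of a finite set of players $\mathcal{N}=\{1,\dots,N\}$, action sets $\mathcal{X}_i$ (here $\mathcal{X}_i=\mathbb{R}^{n_i}$), and payoff functions $u_i:\mathcal{X}\to\mathbb{R}$ such that each $u_i$ is continuous in $\mathbf{x}$, continuously differentiable in $x_i$, and the partial gradient $\nabla_{x_i}u_i(\mathbf{x})$ is Lipschitz continuous in $\mathbf{x}$. Write $v_i(\mathbf{x})=\nabla_{x_i}u_i(\mathbf{x})$ and $\mathbf{v}(\mathbf{x})=(v_1(\mathbf{x}),\dots,v_N(\mathbf{x}))$. A point $\mathbf{x}^*\in\mathcal{X}$ is a Nash equilibrium if for every $i$, $u_i(x_i^*,\mathbf{x}_{-i}^* )\ge u_i(x_i,\mathbf{x}_{-i}^* )$ for all $x_i\in\mathcal{X}_i$, where $\mathbf{x}_{-i}$ denotes the joint action of all players except $i$. The game is $\lambda$-cocoercive if $(\mathbf{x}'-\mathbf{x})^\top(\mathbf{v}(\mathbf{x}')-\mathbf{v}(\mathbf{x}))\le-\lambda\|\mathbf{v}(\mathbf{x}')-\mathbf{v}(\mathbf{x})\|^2$ for all $\mathbf{x},\mathbf{x}'\in\mathcal{X}$. The norm $\|\cdot\|$ is Euclidean, and $\epsilon(\mathbf{x})=\|\mathbf{v}(\mathbf{x})\|^2$. The initial point $\mathbf{x}_0$ is arbitrary (deterministic). The noise $(\xi_t)_{t\ge1}$ is an $L^2$-bounded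 martingale difference sequence adapted to the history $(\mathcal{F}_t)$ of the iterates ($\mathbf{x}_t$ and $\xi_t$ are $\mathcal{F}_t$-measurable). The step-sizes $\eta_t>0$ form a deterministic nonincreasing sequence, and the $\tau_t$ are deterministic. *)

theory Defs
  imports "HOL-Probability.Probability"
begin

(* A game with player set 'p and pairwise unrelated dimensions n_i is encoded on a single
   space real^'k, the product of the action spaces: "owner k" is the player to whom coordinate
   k belongs, so that n_i = card {k. owner k = i} and a joint action is the concatenation of
   the individual actions.  Every tuple (n_1,...,n_N) with at least one positive entry arises. *)

(* The joint action (y_i, x_{-i}); only the coordinates of y owned by player i are used. *)
definition deviate :: "('k::finite \<Rightarrow> 'p) \<Rightarrow> 'p \<Rightarrow> real^'k \<Rightarrow> real^'k \<Rightarrow> real^'k" where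
  "deviate owner i y x = (\<chi> k. if owner k = i then y $ k else x $ k)"

(* g is the gradient of u in x_i at the joint action x.  The function differentiated depends on
   its argument only through the block of player i, so the unique such g, if there is one,
   vanishes outside that block: it is the vector nabla_{x_i} u(x) padded with zeros. *)
definition has_partial_gradient ::
  "('k::finite \<Rightarrow> 'p) \<Rightarrow> 'p \<Rightarrow> (real^'k \<Rightarrow> real) \<Rightarrow> real^'k \<Rightarrow> real^'k \<Rightarrow> bool" where
  "has_partial_gradient owner i u x g \<longleftrightarrow> GDERIV (\<lambda>y. u (deviate owner i y x)) x :> g"

definition partial_gradient ::
  "('k::finite \<Rightarrow> 'p) \<Rightarrow> 'p \<Rightarrow> (real^'k \<Rightarrow> real) \<Rightarrow> real^'k \<Rightarrow> real^'k" where
  "partial_gradient owner i u x = (THE g. has_partial_gradient owner i u x g)"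

definition game_gradient ::
  "('k::finite \<Rightarrow> 'p) \<Rightarrow> ('p \<Rightarrow> real^'k \<Rightarrow> real) \<Rightarrow> real^'k \<Rightarrow> real^'k" where
  "game_gradient owner u x = (\<chi> k. partial_gradient owner (owner k) (u (owner k)) x $ k)"

definition continuous_game :: "('k::finite \<Rightarrow> 'p::finite) \<Rightarrow> ('p \<Rightarrow> real^'k \<Rightarrow> real) \<Rightarrow> bool" where
  "continuous_game owner u \<longleftrightarrow>
     (\<forall>i. continuous_on UNIV (u i) \<and>
          (\<forall>x. \<exists>g. has_partial_gradient owner i (u i) x g) \<and>
          (\<forall>x. continuous_on UNIV (\<lambda>y. partial_gradient owner i (u i) (deviate owner i y x))) \<and>
          (\<exists>L. L-lipschitz_on UNIV (partial_gradient owner i (u i))))"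

definition nash_equilibria ::
  "('k::finite \<Rightarrow> 'p::finite) \<Rightarrow> ('p \<Rightarrow> real^'k \<Rightarrow> real) \<Rightarrow> (real^'k) set" where
  "nash_equilibria owner u = {x. \<forall>i y. u i x \<ge> u i (deviate owner i y x)}"

definition cocoercive_game ::
  "real \<Rightarrow> ('k::finite \<Rightarrow> 'p::finite) \<Rightarrow> ('p \<Rightarrow> real^'k \<Rightarrow> real) \<Rightarrow> bool" where
  "cocoercive_game l owner u \<longleftrightarrow> continuous_game owner u \<and>
     (\<forall>x x'. (x' - x) \<bullet> (game_gradient owner u x' - game_gradient owner u x)
             \<le> - l * (norm (game_gradient owner u x' - game_gradient owner u x))\<^sup>2)"

definition residual ::
  "('k::finite \<Rightarrow> 'p::finite) \<Rightarrow> ('p \<Rightarrow> real^'k \<Rightarrow> real) \<Rightarrow> real^'k \<Rightarrow> real" where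
  "residual owner u x = (norm (game_gradient owner u x))\<^sup>2"

definition vec_cond_exp ::
  "'a measure \<Rightarrow> 'a measure \<Rightarrow> ('a \<Rightarrow> real^'k) \<Rightarrow> 'a \<Rightarrow> real^'k" where
  "vec_cond_exp M F f w = (\<chi> k. real_cond_exp M F (\<lambda>w. f w $ k) w)"

(* The noise is indexed by t >= 1; the value of xi at 0 plays no role. *)
definition L2_bounded_martingale_difference ::
  "'a measure \<Rightarrow> (nat \<Rightarrow> 'a measure) \<Rightarrow> (nat \<Rightarrow> 'a \<Rightarrow> real^'k::finite) \<Rightarrow> bool" where
  "L2_bounded_martingale_difference M F \<xi> \<longleftrightarrow>
     (\<forall>t\<ge>1. \<xi> t \<in> borel_measurable (F t)) \<and>
     (\<exists>C. \<forall>t\<ge>1. integrable M (\<lambda>w. (norm (\<xi> t w))\<^sup>2) \<and> (\<integral>w. (norm (\<xi> t w))\<^sup>2 \<partial>M) \<le> C) \<and>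
     (\<forall>t. AE w in M. vec_cond_exp M (F t) (\<xi> (Suc t)) w = 0)"

end

theory Submission
  imports Defs "HOL-Real_Asymp.Real_Asymp"
begin

text \<open>Let \<open>e\<close> be the expected squared norm of the game gradient along the iterates. Expanding the
  squared distance to a Nash equilibrium, where the gradient vanishes, shows that \<open>\<Sum>t. e t\<close> is
  finite; expanding the squared gradient shows \<open>e (t + 1) \<le> (1 + \<tau> t) e t\<close>. Summing
  \<open>e T \<le> e t + (\<Sum>s=t..<T. \<tau> s * e s)\<close> over \<open>t \<le> T\<close> and using
  \<open>(s + 1) \<tau> s \<le> (\<Sum>r\<le>s. \<tau> r)\<close>, which is monotonicity of \<open>\<tau>\<close>, gives
  \<open>(T + 1) e T = O(1 + (\<Sum>t<T. \<tau> t))\<close>. Since \<open>\<tau> 0 > 0\<close>, the averages of \<open>\<tau>\<close>, and hence \<open>a\<close>,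
  are never smaller than order \<open>1 / T\<close>, so the second case of the rate is void.\<close>

section \<open>Weighted summation of a nearly nonincreasing sequence\<close>

lemma last_le_average_of_summable:
  fixes e \<tau> :: "nat \<Rightarrow> real"
  assumes e_nonneg: "\<And>t. 0 \<le> e t"
    and \<tau>_nonneg: "\<And>t. 0 \<le> \<tau> t"
    and \<tau>_antimono: "\<And>s t. s \<le> t \<Longrightarrow> \<tau> t \<le> \<tau> s"
    and step: "\<And>t. e (Suc t) \<le> (1 + \<tau> t) * e t"
    and sum_le: "\<And>T. (\<Sum>t<T. e t) \<le> C"
  shows "(real T + 1) * e T \<le> C * (1 + (\<Sum>t<T. \<tau> t))"
proof -
  have weighted: "(real T + 1) * e T \<le> (\<Sum>t<Suc T. e t) + (\<Sum>s<T. (real s + 1) * \<tau> s * e s)"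
  proof (induction T)
    case (Suc T)
    \<comment> \<open>Of the \<open>T + 2\<close> copies of \<open>e (Suc T)\<close>, one becomes
      the new last term of the first sum; only the other \<open>T + 1\<close> go through
      \<open>step\<close>.\<close>
    have "(real T + 1) * e (Suc T) \<le> (real T + 1) * ((1 + \<tau> T) * e T)"
      by (intro mult_left_mono step) auto
    with Suc show ?case by (simp add: algebra_simps)
  qed simp
  have weight: "(real s + 1) * \<tau> s \<le> (\<Sum>r<T. \<tau> r)" if "s < T" for s
  proof -
    have "(real s + 1) * \<tau> s = (\<Sum>r<Suc s. \<tau> s)" by simp
    also have "\<dots> \<le> (\<Sum>r<Suc s. \<tau> r)" by (intro sum_mono \<tau>_antimono) auto
    also have "\<dots> \<le> (\<Sum>r<T. \<tau> r)" by (intro sum_mono2) (use that \<tau>_nonneg in auto)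
    finally show ?thesis .
  qed
  \<comment> \<open>The bound on the weights is uniform in \<open>s\<close>, so it factors out and
    leaves a partial sum of \<open>e\<close>.\<close>
  have "(\<Sum>s<T. (real s + 1) * \<tau> s * e s) \<le> (\<Sum>s<T. (\<Sum>r<T. \<tau> r) * e s)"
    by (intro sum_mono mult_right_mono weight e_nonneg) auto
  also have "\<dots> = (\<Sum>r<T. \<tau> r) * (\<Sum>s<T. e s)" by (simp add: sum_distrib_left)
  also have "\<dots> \<le> (\<Sum>r<T. \<tau> r) * C" by (intro mult_left_mono sum_le sum_nonneg \<tau>_nonneg)
  \<comment> \<open>The first sum in \<open>weighted\<close> includes the index \<open>T\<close>, so
    \<open>sum_le\<close> is taken at \<open>Suc T\<close>; this produces the summand 1.\<close>
  finally show ?thesis using weighted sum_le[of "Suc T"] by (simp add: algebra_simps)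
qed

section \<open>First-order conditions and regularity of the gradient\<close>

text \<open>Fermat's rule: deviating to one's own action changes nothing, so the maximum over
  \<open>y\<close> is attained at \<open>y = x\<close>, an interior point of the whole space. Every
  partial gradient at \<open>x\<close> is therefore 0, and since one exists, \<open>THE\<close>
  selects 0.\<close>

lemma partial_gradient_eq_0_at_max:
  assumes "has_partial_gradient owner i f x g"
    and "\<And>y. f (deviate owner i y x) \<le> f x"
  shows "partial_gradient owner i f x = 0"
proof -
  have "deviate owner i x x = x"
    by (simp add: deviate_def vec_eq_iff)
  have zero: "h = 0" if "has_partial_gradient owner i f x h" for h
  proof -
    have "((\<lambda>y. f (deviate owner i y x)) has_derivative (\<lambda>z. z \<bullet> h)) (at x)"
      using that by (simp add: has_partial_gradient_def gderiv_def)
    then have "(\<lambda>z. z \<bullet> h) = (\<lambda>z. 0)"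
      using assms(2) \<open>deviate owner i x x = x\<close>
      by (intro differential_zero_maxmin[where S = UNIV and f = "\<lambda>y. f (deviate owner i y x)"]) auto
    then show ?thesis by (metis inner_eq_zero_iff)
  qed
  show ?thesis
    unfolding partial_gradient_def using assms(1) zero by (metis the_equality)
qed

text \<open>Through this fact cocoercivity against an equilibrium \<open>z\<close> becomes a bound
  of \<open>(y - z) \<bullet> v y\<close> by a negative multiple of the squared norm of
  \<open>v y\<close>.\<close>

lemma game_gradient_eq_0_at_nash:
  assumes "continuous_game owner u" "z \<in> nash_equilibria owner u"
  shows "game_gradient owner u z = 0"
proof -
  have "partial_gradient owner i (u i) z = 0" for i
  proof -
    obtain g where "has_partial_gradient owner i (u i) z g"
      using assms(1) unfolding continuous_game_def by blast
    then show ?thesis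
      using assms(2) by (intro partial_gradient_eq_0_at_max) (auto simp: nash_equilibria_def)
  qed
  then show ?thesis by (simp add: game_gradient_def vec_eq_iff)
qed

text \<open>Cauchy-Schwarz bounds the inner product, and a factor \<open>norm (v y - v x)\<close>
  cancels unless it is 0. The result makes \<open>v\<close> measurable and passes square
  integrability from the iterates to their gradients.\<close>

lemma cocoercive_imp_lipschitz:
  fixes v :: "'b::euclidean_space \<Rightarrow> 'b"
  assumes "0 < l"
    and "\<And>x y. (y - x) \<bullet> (v y - v x) \<le> - l * (norm (v y - v x))\<^sup>2"
  shows "(1 / l)-lipschitz_on UNIV v"
proof (rule lipschitz_onI)
  fix x y
  have "l * (norm (v y - v x))\<^sup>2 \<le> \<bar>(y - x) \<bullet> (v y - v x)\<bar>" using assms(2)[of y x] by linarith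
  also have "\<dots> \<le> norm (y - x) * norm (v y - v x)" by (rule Cauchy_Schwarz_ineq2)
  finally have "l * norm (v y - v x) \<le> norm (y - x)"
    by (cases "v y = v x") (auto simp: power2_eq_square)
  then show "dist (v x) (v y) \<le> 1 / l * dist x y"
    using assms(1) by (simp add: dist_norm norm_minus_commute field_simps)
qed (use assms(1) in simp)

section \<open>Square integrable random vectors\<close>

text \<open>Measurability of \<open>f\<close> is a separate conjunct because integrability of its
  squared norm does not imply it.\<close>

definition square_integrable :: "'a measure \<Rightarrow> ('a \<Rightarrow> 'b::euclidean_space) \<Rightarrow> bool" where
  "square_integrable M f \<longleftrightarrow> f \<in> borel_measurable M \<and> integrable M (\<lambda>w. (norm (f w))\<^sup>2)"

lemma square_integrable_bound:
  assumes "square_integrable M f" "g \<in> borel_measurable M"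
    and "\<And>w. w \<in> space M \<Longrightarrow> norm (g w) \<le> c * norm (f w)"
  shows "square_integrable M g"
proof -
  have "integrable M (\<lambda>w. (norm (g w))\<^sup>2)"
  proof (rule Bochner_Integration.integrable_bound)
    show "integrable M (\<lambda>w. c\<^sup>2 * (norm (f w))\<^sup>2)"
      using assms(1) by (simp add: square_integrable_def)
    show "AE w in M. norm ((norm (g w))\<^sup>2) \<le> norm (c\<^sup>2 * (norm (f w))\<^sup>2)"
    proof (rule AE_I2)
      fix w assume "w \<in> space M"
      from assms(3)[OF this] have "(norm (g w))\<^sup>2 \<le> (c * norm (f w))\<^sup>2"
        by (intro power_mono) auto
      then show "norm ((norm (g w))\<^sup>2) \<le> norm (c\<^sup>2 * (norm (f w))\<^sup>2)"
        by (simp add: power_mult_distrib)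
    qed
  qed (use assms(2) in measurable)
  with assms(2) show ?thesis by (simp add: square_integrable_def)
qed

lemma square_integrable_scaleR:
  "square_integrable M f \<Longrightarrow> square_integrable M (\<lambda>w. c *\<^sub>R f w)"
  by (rule square_integrable_bound[where c = "\<bar>c\<bar>"]) (auto simp: square_integrable_def)

text \<open>The parallelogram law with the square of \<open>norm (a - b)\<close> dropped.\<close>

lemma norm_add_sq_le:
  fixes a b :: "'b::real_inner"
  shows "(norm (a + b))\<^sup>2 \<le> 2 * (norm a)\<^sup>2 + 2 * (norm b)\<^sup>2"
  using zero_le_power2[of "norm (a - b)"]
  by (simp add: power2_norm_eq_inner algebra_simps inner_commute)

lemma abs_inner_le_add_sq:
  fixes a b :: "'b::real_inner"
  shows "\<bar>a \<bullet> b\<bar> \<le> (norm a)\<^sup>2 + (norm b)\<^sup>2"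
proof -
  have "\<bar>a \<bullet> b\<bar> \<le> norm a * norm b" by (rule Cauchy_Schwarz_ineq2)
  also have "\<dots> \<le> (norm a)\<^sup>2 + (norm b)\<^sup>2"
    using zero_le_power2[of "norm a - norm b"] zero_le_power2[of "norm a + norm b"]
    unfolding power2_sum power2_diff by linarith
  finally show ?thesis .
qed

lemma square_integrable_add:
  assumes "square_integrable M f" "square_integrable M g"
  shows "square_integrable M (\<lambda>w. f w + g w)"
proof -
  have [measurable]: "f \<in> borel_measurable M" "g \<in> borel_measurable M"
    using assms by (auto simp: square_integrable_def)
  have "integrable M (\<lambda>w. (norm (f w + g w))\<^sup>2)"
  proof (rule Bochner_Integration.integrable_bound)
    show "integrable M (\<lambda>w. 2 * (norm (f w))\<^sup>2 + 2 * (norm (g w))\<^sup>2)"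
      using assms by (simp add: square_integrable_def)
    show "AE w in M. norm ((norm (f w + g w))\<^sup>2) \<le> norm (2 * (norm (f w))\<^sup>2 + 2 * (norm (g w))\<^sup>2)"
      by (simp add: norm_add_sq_le)
  qed measurable
  then show ?thesis by (simp add: square_integrable_def)
qed

lemma square_integrable_inner:
  assumes "square_integrable M f" "square_integrable M g"
  shows "integrable M (\<lambda>w. f w \<bullet> g w)"
proof (rule Bochner_Integration.integrable_bound)
  show "integrable M (\<lambda>w. (norm (f w))\<^sup>2 + (norm (g w))\<^sup>2)"
    using assms by (simp add: square_integrable_def)
  show "AE w in M. norm (f w \<bullet> g w) \<le> norm ((norm (f w))\<^sup>2 + (norm (g w))\<^sup>2)"
    by (simp add: abs_inner_le_add_sq)
qed (use assms in \<open>auto simp: square_integrable_def\<close>)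

text \<open>In each coordinate the \<open>F\<close>-measurable factor is pulled out of the
  conditional expectation, which leaves it multiplied by the vanishing conditional mean of
  \<open>g\<close>. Square integrability makes the coordinate products integrable.\<close>

lemma integral_inner_eq_0:
  fixes f g :: "'a \<Rightarrow> real^'k::finite"
  assumes "sigma_finite_subalgebra M F"
    and f: "square_integrable M f" "f \<in> borel_measurable F"
    and g: "square_integrable M g"
    and centred: "AE w in M. vec_cond_exp M F g w = 0"
  shows "(\<integral>w. f w \<bullet> g w \<partial>M) = 0"
proof -
  interpret sigma_finite_subalgebra M F by fact
  have fg[measurable]: "f \<in> borel_measurable M" "g \<in> borel_measurable M"
    using f g by (auto simp: square_integrable_def)
  have comp: "square_integrable M (\<lambda>w. h w $ k)" if "square_integrable M h"
    for h :: "'a \<Rightarrow> real^'k" and k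
  proof (rule square_integrable_bound[OF that, where c = 1])
    have "h \<in> borel_measurable M" using that by (simp add: square_integrable_def)
    then show "(\<lambda>w. h w $ k) \<in> borel_measurable M"
      by (rule measurable_compose) (intro borel_measurable_continuous_onI continuous_intros)
  qed (simp add: component_le_norm_cart)
  have int: "integrable M (\<lambda>w. f w $ k * g w $ k)" for k
    using square_integrable_inner[OF comp[OF f(1), of k] comp[OF g, of k]] by simp
  have "(\<integral>w. f w $ k * g w $ k \<partial>M) = 0" for k
  proof -
    have "(\<lambda>w. f w $ k) \<in> borel_measurable F"
      using f(2) by (rule measurable_compose) (intro borel_measurable_continuous_onI continuous_intros)
    moreover have "(\<lambda>w. g w $ k) \<in> borel_measurable M"
      using comp[OF g, of k] by (simp add: square_integrable_def)
    ultimately have "(\<integral>w. f w $ k * g w $ k \<partial>M)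
        = (\<integral>w. f w $ k * real_cond_exp M F (\<lambda>w. g w $ k) w \<partial>M)"
      using real_cond_exp_intg(2) int by metis
    also have "\<dots> = 0"
    proof (rule integral_eq_zero_AE)
      show "AE w in M. f w $ k * real_cond_exp M F (\<lambda>w. g w $ k) w = 0"
        using centred by eventually_elim (simp add: vec_cond_exp_def vec_eq_iff)
    qed
    finally show ?thesis .
  qed
  then show ?thesis by (simp add: inner_vec_def Bochner_Integration.integral_sum[OF int])
qed

section \<open>One-step inequalities for the iteration\<close>

text \<open>Here \<open>w\<close> stands for the gradient at \<open>y\<close> and \<open>h\<close>
  for the step size. Only \<open>(y - z) \<bullet> w\<close> is estimated; the inner products with
  the noise stay exact, because they vanish in expectation.\<close>

lemma cocoercive_step_distance:
  fixes y z \<xi> w :: "'b::real_inner"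
  assumes "(y - z) \<bullet> w \<le> - l * (norm w)\<^sup>2" "0 \<le> h"
  shows "(norm (y + h *\<^sub>R (w + \<xi>) - z))\<^sup>2
    \<le> (norm (y - z))\<^sup>2 - 2 * h * l * (norm w)\<^sup>2 + h\<^sup>2 * (norm w)\<^sup>2 + h\<^sup>2 * (norm \<xi>)\<^sup>2
      + 2 * h * ((y - z) \<bullet> \<xi>) + 2 * h\<^sup>2 * (w \<bullet> \<xi>)"
proof -
  have split: "y + h *\<^sub>R (w + \<xi>) - z = (y - z) + h *\<^sub>R (w + \<xi>)" by simp
  have "(norm (y + h *\<^sub>R (w + \<xi>) - z))\<^sup>2
      = (norm (y - z))\<^sup>2 + 2 * h * ((y - z) \<bullet> w) + h\<^sup>2 * (norm w)\<^sup>2 + h\<^sup>2 * (norm \<xi>)\<^sup>2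
        + 2 * h * ((y - z) \<bullet> \<xi>) + 2 * h\<^sup>2 * (w \<bullet> \<xi>)"
    unfolding split power2_norm_eq_inner inner_add_left inner_add_right
      inner_scaleR_left inner_scaleR_right
    by (simp add: inner_commute algebra_simps power2_eq_square)
  moreover have "2 * h * ((y - z) \<bullet> w) \<le> 2 * h * (- l * (norm w)\<^sup>2)"
    using assms by (intro mult_left_mono) auto
  ultimately show ?thesis by (simp add: algebra_simps)
qed

text \<open>Cocoercivity gives \<open>2 a \<bullet> d + 2 \<xi> \<bullet> d \<le> - 2 (l / h) \<parallel>d\<parallel>\<^sup>2 \<le> - 2 \<parallel>d\<parallel>\<^sup>2\<close>
  for \<open>d = b - a\<close>. One copy of \<open>\<parallel>d\<parallel>\<^sup>2\<close> cancels the quadratic term of \<open>\<parallel>a + d\<parallel>\<^sup>2\<close>, the other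
  absorbs \<open>- 2 \<xi> \<bullet> d\<close>.\<close>

lemma cocoercive_step_residual:
  fixes a b \<xi> :: "'b::real_inner"
  assumes "(h *\<^sub>R (a + \<xi>)) \<bullet> (b - a) \<le> - l * (norm (b - a))\<^sup>2" "0 < h" "h \<le> l"
  shows "(norm b)\<^sup>2 \<le> (norm a)\<^sup>2 + (norm \<xi>)\<^sup>2"
proof -
  define d where "d = b - a"
  have "h * ((a + \<xi>) \<bullet> d) \<le> - l * (norm d)\<^sup>2" using assms(1) by (simp add: d_def)
  also have "\<dots> \<le> h * (- (norm d)\<^sup>2)" using assms(3) by (simp add: mult_right_mono)
  finally have "(a + \<xi>) \<bullet> d \<le> - (norm d)\<^sup>2"
    using assms(2) by (simp only: mult_le_cancel_left_pos)
  then have "a \<bullet> d + \<xi> \<bullet> d \<le> - (d \<bullet> d)" by (simp add: inner_add_left power2_norm_eq_inner)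
  moreover have "0 \<le> (\<xi> + d) \<bullet> (\<xi> + d)" by simp
  then have "0 \<le> \<xi> \<bullet> \<xi> + 2 * (\<xi> \<bullet> d) + d \<bullet> d" by (simp add: inner_commute algebra_simps)
  moreover have "b \<bullet> b = a \<bullet> a + 2 * (a \<bullet> d) + d \<bullet> d"
    by (simp add: d_def inner_commute algebra_simps)
  ultimately show ?thesis by (simp add: power2_norm_eq_inner)
qed

section \<open>Expected gradient norms along the iterates\<close>

text \<open>Taking expectations in the two one-step inequalities gives \<open>descent\<close> and
  \<open>step\<close>. Telescoping the first bounds the partial sums of \<open>e\<close> by a
  constant, and \<open>last_le_average_of_summable\<close> combines this with the second.\<close>

lemma cocoercive_sgd_relative_noise:
  fixes v :: "real^'k \<Rightarrow> real^'k::finite" and x \<xi> :: "nat \<Rightarrow> 'a \<Rightarrow> real^'k"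
  assumes "prob_space M"
    and sub: "\<And>t. subalgebra M (F t)"
    and adapted: "\<And>t. x t \<in> borel_measurable (F t)"
    and noise: "L2_bounded_martingale_difference M F \<xi>"
    and relative: "\<And>t. AE w in M. real_cond_exp M (F t) (\<lambda>w. (norm (\<xi> (Suc t) w))\<^sup>2) w
                         \<le> \<tau> t * (norm (v (x t w)))\<^sup>2"
    and \<tau>: "\<And>t. 0 \<le> \<tau> t" "\<And>t. \<tau> t \<le> \<tau>m" "\<And>s t. s \<le> t \<Longrightarrow> \<tau> t \<le> \<tau> s"
    and l: "0 < l"
    and coco: "\<And>y y'. (y' - y) \<bullet> (v y' - v y) \<le> - l * (norm (v y' - v y))\<^sup>2"
    and zero: "v z = 0"
    and init: "\<And>w. w \<in> space M \<Longrightarrow> x 0 w = x0"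
    and rec: "\<And>t w. w \<in> space M \<Longrightarrow> x (Suc t) w = x t w + \<eta> (Suc t) *\<^sub>R (v (x t w) + \<xi> (Suc t) w)"
    and \<eta>: "0 < \<eta>lo" "\<And>t. 1 \<le> t \<Longrightarrow> \<eta>lo \<le> \<eta> t" "\<And>t. 1 \<le> t \<Longrightarrow> \<eta> t * (1 + \<tau>m) \<le> l"
  shows "integrable M (\<lambda>w. (norm (v (x T w)))\<^sup>2)"
    and "(real T + 1) * (\<integral>w. (norm (v (x T w)))\<^sup>2 \<partial>M)
      \<le> (norm (x0 - z))\<^sup>2 / (\<eta>lo * l) * (1 + (\<Sum>t<T. \<tau> t))"
proof -
  interpret prob_space M by fact
  have subalg: "sigma_finite_subalgebra M (F t)" for t
    using sub[of t] by (intro finite_measure_subalgebra_is_sigma_finite)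
      (simp add: finite_measure_subalgebra_def finite_measure_subalgebra_axioms_def
        finite_measure_axioms)
  have F_imp_M: "f \<in> borel_measurable (F t) \<Longrightarrow> f \<in> borel_measurable M"
    for f :: "'a \<Rightarrow> real^'k" and t
    using sub[of t] measurable_from_subalg by blast
  have lip: "(1 / l)-lipschitz_on UNIV v" using cocoercive_imp_lipschitz[OF l coco] .
  then have v_meas[measurable]: "v \<in> borel_measurable borel"
    by (intro borel_measurable_continuous_onI lipschitz_on_continuous_on)
  have v_bound: "norm (v y) \<le> 1 / l * norm (y - z)" for y
    using lipschitz_onD[OF lip, of y z] zero by (simp add: dist_norm)
  have \<xi>_sq: "square_integrable M (\<xi> (Suc t))" for t
    using noise F_imp_M[of "\<xi> (Suc t)" "Suc t"]
    by (fastforce simp: L2_bounded_martingale_difference_def square_integrable_def)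
  have v_adapted: "(\<lambda>w. v (x t w)) \<in> borel_measurable (F t)" for t
    using adapted[of t] v_meas by (rule measurable_compose)
  \<comment> \<open>Conditional on \<open>x t\<close>, because the induction for \<open>x_sq\<close>
    needs it at \<open>t\<close> to reach \<open>Suc t\<close>.\<close>
  have v_sq: "square_integrable M (\<lambda>w. v (x t w))" if "square_integrable M (\<lambda>w. x t w - z)" for t
    using that by (rule square_integrable_bound[where c = "1 / l"])
      (use v_bound F_imp_M[OF v_adapted] in auto)
  have x_meas[measurable]: "x t \<in> borel_measurable M" for t
    using F_imp_M[OF adapted] .
  have x_sq: "square_integrable M (\<lambda>w. x t w - z)" for t
  proof (induction t)
    case 0
    have "square_integrable M (\<lambda>w. x0 - z)" by (simp add: square_integrable_def)
    then show ?case by (rule square_integrable_bound[where c = 1]) (auto simp: init)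
  next
    case (Suc t)
    have "square_integrable M (\<lambda>w. (x t w - z) + \<eta> (Suc t) *\<^sub>R (v (x t w) + \<xi> (Suc t) w))"
      by (intro square_integrable_add square_integrable_scaleR Suc v_sq \<xi>_sq)
    then show ?case
      by (rule square_integrable_bound[where c = 1]) (auto simp: rec algebra_simps)
  qed
  note v_sq = v_sq[OF x_sq]
  note sq_int = v_sq[unfolded square_integrable_def, THEN conjunct2]
    \<xi>_sq[unfolded square_integrable_def, THEN conjunct2]
    x_sq[unfolded square_integrable_def, THEN conjunct2]
  show "integrable M (\<lambda>w. (norm (v (x T w)))\<^sup>2)" by (rule sq_int)
  define e where "e t = (\<integral>w. (norm (v (x t w)))\<^sup>2 \<partial>M)" for t
  define D where "D t = (\<integral>w. (norm (x t w - z))\<^sup>2 \<partial>M)" for t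
  define N where "N t = (\<integral>w. (norm (\<xi> (Suc t) w))\<^sup>2 \<partial>M)" for t
  have e_nonneg: "0 \<le> e t" and D_nonneg: "0 \<le> D t" for t by (simp_all add: e_def D_def)
  have noise_le: "N t \<le> \<tau> t * e t" for t
  proof -
    interpret sigma_finite_subalgebra M "F t" by (rule subalg)
    have "N t = (\<integral>w. real_cond_exp M (F t) (\<lambda>w. (norm (\<xi> (Suc t) w))\<^sup>2) w \<partial>M)"
      unfolding N_def by (rule real_cond_exp_int(2)[symmetric]) (rule sq_int)
    also have "\<dots> \<le> (\<integral>w. \<tau> t * (norm (v (x t w)))\<^sup>2 \<partial>M)"
      by (intro integral_mono_AE relative real_cond_exp_int(1) integrable_mult_right sq_int)
    finally show ?thesis by (simp add: e_def)
  qed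
  have centred: "AE w in M. vec_cond_exp M (F t) (\<xi> (Suc t)) w = 0" for t
    using noise by (simp add: L2_bounded_martingale_difference_def)
  have cross_x: "(\<integral>w. (x t w - z) \<bullet> \<xi> (Suc t) w \<partial>M) = 0" for t
    by (rule integral_inner_eq_0[OF subalg x_sq _ \<xi>_sq centred])
      (use adapted[of t] in simp)
  have cross_v: "(\<integral>w. v (x t w) \<bullet> \<xi> (Suc t) w \<partial>M) = 0" for t
    by (rule integral_inner_eq_0[OF subalg v_sq v_adapted \<xi>_sq centred])
  have descent: "\<eta>lo * l * e t \<le> D t - D (Suc t)" for t
  proof -
    let ?h = "\<eta> (Suc t)"
    have h: "0 < ?h" "\<eta>lo \<le> ?h" "?h * (1 + \<tau>m) \<le> l"
      using \<eta>(1) \<eta>(2)[of "Suc t"] \<eta>(3)[of "Suc t"] by auto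
    have "D (Suc t) \<le> (\<integral>w. (norm (x t w - z))\<^sup>2 - 2 * ?h * l * (norm (v (x t w)))\<^sup>2
        + ?h\<^sup>2 * (norm (v (x t w)))\<^sup>2 + ?h\<^sup>2 * (norm (\<xi> (Suc t) w))\<^sup>2
        + 2 * ?h * ((x t w - z) \<bullet> \<xi> (Suc t) w) + 2 * ?h\<^sup>2 * (v (x t w) \<bullet> \<xi> (Suc t) w) \<partial>M)"
      unfolding D_def
    proof (rule integral_mono)
      fix w assume w: "w \<in> space M"
      show "(norm (x (Suc t) w - z))\<^sup>2 \<le> (norm (x t w - z))\<^sup>2 - 2 * ?h * l * (norm (v (x t w)))\<^sup>2
        + ?h\<^sup>2 * (norm (v (x t w)))\<^sup>2 + ?h\<^sup>2 * (norm (\<xi> (Suc t) w))\<^sup>2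
        + 2 * ?h * ((x t w - z) \<bullet> \<xi> (Suc t) w) + 2 * ?h\<^sup>2 * (v (x t w) \<bullet> \<xi> (Suc t) w)"
        unfolding rec[OF w] using coco[of "x t w" z] zero h(1)
        by (intro cocoercive_step_distance) auto
    qed (intro Bochner_Integration.integrable_add Bochner_Integration.integrable_diff
        integrable_mult_right sq_int square_integrable_inner x_sq v_sq \<xi>_sq)+
    also have "\<dots> = D t - 2 * ?h * l * e t + ?h\<^sup>2 * e t + ?h\<^sup>2 * N t"
      using sq_int square_integrable_inner[OF x_sq \<xi>_sq] square_integrable_inner[OF v_sq \<xi>_sq]
      by (simp add: D_def e_def N_def cross_x cross_v)
    also have "\<dots> \<le> D t - 2 * ?h * l * e t + ?h\<^sup>2 * e t + ?h\<^sup>2 * (\<tau>m * e t)"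
      using noise_le[of t] mult_right_mono[OF \<tau>(2) e_nonneg, of t t]
      by (intro add_left_mono mult_left_mono) auto
    \<comment> \<open>The term \<open>2 * ?h * l * e t\<close> is split: one half is kept as
      decrease, the other pays for gradient and noise since
      \<open>?h * (1 + \<tau>m) \<le> l\<close>.\<close>
    also have "\<dots> = D t - ?h * l * e t - ?h * e t * (l - ?h * (1 + \<tau>m))"
      by (simp add: algebra_simps power2_eq_square)
    also have "\<dots> \<le> D t - ?h * l * e t" using h e_nonneg by simp
    finally have "?h * l * e t \<le> D t - D (Suc t)" by simp
    moreover have "\<eta>lo * (l * e t) \<le> ?h * (l * e t)"
      using h l e_nonneg by (intro mult_right_mono) auto
    ultimately show ?thesis by (simp add: algebra_simps)
  qed
  have "D 0 = (\<integral>w. (norm (x0 - z))\<^sup>2 \<partial>M)"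
    unfolding D_def by (rule Bochner_Integration.integral_cong) (auto simp: init)
  then have D0: "D 0 = (norm (x0 - z))\<^sup>2" by (simp add: prob_space)
  have sum_le: "(\<Sum>t<T. e t) \<le> (norm (x0 - z))\<^sup>2 / (\<eta>lo * l)" for T
  proof -
    have "\<eta>lo * l * (\<Sum>t<T. e t) = (\<Sum>t<T. \<eta>lo * l * e t)" by (simp add: sum_distrib_left)
    also have "\<dots> \<le> (\<Sum>t<T. D t - D (Suc t))" by (intro sum_mono descent)
    also have "\<dots> = D 0 - D T" by (rule sum_lessThan_telescope')
    also have "\<dots> \<le> D 0" using D_nonneg by simp
    finally show ?thesis using \<eta>(1) l D0 by (simp add: field_simps)
  qed
  \<comment> \<open>In contrast to \<open>descent\<close>, the current \<open>\<tau> t\<close> is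
    kept instead of \<open>\<tau>m\<close>: the decay of \<open>\<tau>\<close> determines the final
    rate.\<close>
  have step: "e (Suc t) \<le> (1 + \<tau> t) * e t" for t
  proof -
    let ?h = "\<eta> (Suc t)"
    have h: "0 < ?h" using \<eta>(1) \<eta>(2)[of "Suc t"] by simp
    have "?h \<le> ?h * (1 + \<tau>m)" using h \<tau>(1)[of 0] \<tau>(2)[of 0] by simp
    then have hl: "?h \<le> l" using \<eta>(3)[of "Suc t"] by simp
    have "e (Suc t) \<le> (\<integral>w. (norm (v (x t w)))\<^sup>2 + (norm (\<xi> (Suc t) w))\<^sup>2 \<partial>M)"
      unfolding e_def
    proof (rule integral_mono)
      fix w assume "w \<in> space M"
      \<comment> \<open>The displacement between successive iterates is \<open>?h\<close> times
        gradient plus noise, so cocoercivity along it is the premise of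
        \<open>cocoercive_step_residual\<close>.\<close>
      then show "(norm (v (x (Suc t) w)))\<^sup>2 \<le> (norm (v (x t w)))\<^sup>2 + (norm (\<xi> (Suc t) w))\<^sup>2"
        using h hl coco[of "x (Suc t) w" "x t w"]
        by (intro cocoercive_step_residual[where h = ?h and l = l]) (simp_all add: rec)
    qed (intro Bochner_Integration.integrable_add sq_int)+
    also have "\<dots> = e t + N t" unfolding e_def N_def by (intro Bochner_Integration.integral_add sq_int)
    finally show ?thesis using noise_le[of t] by (simp add: algebra_simps)
  qed
  show "(real T + 1) * (\<integral>w. (norm (v (x T w)))\<^sup>2 \<partial>M)
      \<le> (norm (x0 - z))\<^sup>2 / (\<eta>lo * l) * (1 + (\<Sum>t<T. \<tau> t))"
    using last_le_average_of_summable[OF e_nonneg \<tau>(1) \<tau>(3) step sum_le] by (simp add: e_def)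
qed

section \<open>From the averaged bound to the rate for the game\<close>

theorem theorem4p6:
  fixes owner :: "'k::finite \<Rightarrow> 'p::finite"
    and u :: "'p \<Rightarrow> real^'k \<Rightarrow> real"
    and lam tau_max eta_lo eta_hi :: real
    and M :: "'a measure"
    and F :: "nat \<Rightarrow> 'a measure"
    and x \<xi> :: "nat \<Rightarrow> 'a \<Rightarrow> real^'k"
    and x0 :: "real^'k"
    and \<eta> \<tau> :: "nat \<Rightarrow> real"
    and a :: "real \<Rightarrow> real"
  assumes "lam > 0"
    and "cocoercive_game lam owner u"
    and "nash_equilibria owner u \<noteq> {}"
    and "prob_space M"
    and "filtration (space M) F"
    and "\<And>t. subalgebra M (F t)"
    and "\<And>t. x t \<in> borel_measurable (F t)"
    and "L2_bounded_martingale_difference M F \<xi>"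
    and "\<And>w. w \<in> space M \<Longrightarrow> x 0 w = x0"
    and "\<And>t w. w \<in> space M \<Longrightarrow>
           x (Suc t) w = x t w + \<eta> (Suc t) *\<^sub>R (game_gradient owner u (x t w) + \<xi> (Suc t) w)"
    and "\<And>t. AE w in M. real_cond_exp M (F t) (\<lambda>w. (norm (\<xi> (Suc t) w))\<^sup>2) w
                         \<le> \<tau> t * (norm (game_gradient owner u (x t w)))\<^sup>2"
    and "\<And>t. 0 < \<tau> t \<and> \<tau> t \<le> tau_max"
    and "\<And>s t. s \<le> t \<Longrightarrow> \<tau> t \<le> \<tau> s"
    and "\<And>t. 0 < t \<Longrightarrow> 0 \<le> a t"
    and "a \<in> o[at_top](\<lambda>_. 1)"
    and "(\<lambda>T::nat. 1 / (real T + 1) * (\<Sum>t<T. \<tau> t)) \<in> O[at_top](\<lambda>T. a (real T))"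
    and "0 < eta_lo"
    and "\<And>t. 1 \<le> t \<Longrightarrow> eta_lo \<le> \<eta> t \<and> \<eta> t \<le> eta_hi"
    and "\<And>s t. 1 \<le> s \<Longrightarrow> s \<le> t \<Longrightarrow> \<eta> t \<le> \<eta> s"
    and "eta_hi < lam / (1 + tau_max)"
  shows "(\<forall>T. integrable M (\<lambda>w. residual owner u (x T w))) \<and>
         ((\<lambda>T::nat. a (real T)) \<in> \<Omega>[at_top](\<lambda>T. 1 / real T) \<longrightarrow>
           (\<lambda>T. \<integral>w. residual owner u (x T w) \<partial>M) \<in> O[at_top](\<lambda>T. a (real T))) \<and>
         ((\<lambda>T::nat. a (real T)) \<notin> \<Omega>[at_top](\<lambda>T. 1 / real T) \<longrightarrow>
           (\<lambda>T. \<integral>w. residual owner u (x T w) \<partial>M) \<in> O[at_top](\<lambda>T. 1 / real T))"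
proof -
  note [simp] = residual_def
  let ?v = "game_gradient owner u" and ?avg = "\<lambda>T::nat. 1 / (real T + 1) * (\<Sum>t<T. \<tau> t)"
  obtain z where z: "z \<in> nash_equilibria owner u" using assms(3) by blast
  have "continuous_game owner u"
    and coco: "(y' - y) \<bullet> (?v y' - ?v y) \<le> - lam * (norm (?v y' - ?v y))\<^sup>2" for y y'
    using assms(2) by (auto simp: cocoercive_game_def)
  then have zero: "?v z = 0" using game_gradient_eq_0_at_nash z by blast
  have \<tau>_pos: "0 < \<tau> t" and \<tau>_le: "\<tau> t \<le> tau_max" for t using assms(12) by auto
  have "0 < 1 + tau_max" using \<tau>_pos[of 0] \<tau>_le[of 0] by simp
  then have hi: "eta_hi * (1 + tau_max) \<le> lam" using assms(20) by (simp add: field_simps)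
  have \<eta>_le: "\<eta> t * (1 + tau_max) \<le> lam" if "1 \<le> t" for t
    using assms(18)[OF that] \<open>0 < 1 + tau_max\<close>
    by (intro order.trans[OF mult_right_mono hi]) auto
  have \<eta>_ge: "eta_lo \<le> \<eta> t" if "1 \<le> t" for t using assms(18)[OF that] by simp
  define C where "C = (norm (x0 - z))\<^sup>2 / (eta_lo * lam)"
  have C_nonneg: "0 \<le> C" using assms(1,17) by (simp add: C_def)
  note main = cocoercive_sgd_relative_noise[OF assms(4,6,7,8,11) less_imp_le[OF \<tau>_pos] \<tau>_le
      assms(13,1) coco zero assms(9,10,17) \<eta>_ge \<eta>_le, folded C_def]
  \<comment> \<open>The term at index 0 alone gives the bound; \<open>1 \<le> T\<close> ensures that
    it occurs in the sum.\<close>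
  have avg_ge: "\<tau> 0 / (real T + 1) \<le> ?avg T" if "1 \<le> T" for T
  proof -
    have "\<tau> 0 = (\<Sum>t<1. \<tau> t)" by simp
    also have "\<dots> \<le> (\<Sum>t<T. \<tau> t)"
      using that \<tau>_pos by (intro sum_mono2) (auto intro: less_imp_le)
    finally show ?thesis by (simp add: divide_right_mono)
  qed
  have "(\<lambda>T. 1 / real T) \<in> O(\<lambda>T::nat. \<tau> 0 / (real T + 1))"
    using \<tau>_pos[of 0] by real_asymp
  also have "(\<lambda>T::nat. \<tau> 0 / (real T + 1)) \<in> O(?avg)"
  proof (rule landau_o.big_mono)
    show "\<forall>\<^sub>F T in sequentially. norm (\<tau> 0 / (real T + 1)) \<le> norm (?avg T)"
      using eventually_ge_at_top[of 1]
    proof eventually_elim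
      case (elim T)
      then show ?case using avg_ge[OF elim] less_imp_le[OF \<tau>_pos[of 0]]
        by (simp add: abs_of_nonneg sum_nonneg less_imp_le[OF \<tau>_pos])
    qed
  qed
  also note assms(16)
  finally have slow: "(\<lambda>T::nat. a (real T)) \<in> \<Omega>(\<lambda>T. 1 / real T)"
    by (simp add: bigomega_iff_bigo)
  have "(\<lambda>T. \<integral>w. residual owner u (x T w) \<partial>M) \<in> O(?avg)"
  proof (rule landau_o.bigI)
    \<comment> \<open>The factor \<open>1 / \<tau> 0\<close> comes from bounding
      \<open>1 / (real T + 1)\<close> by the average via \<open>avg_ge\<close>. The final
      \<open>+ 1\<close> keeps the constant positive when \<open>C = 0\<close>, that is, when the
      iteration starts at \<open>z\<close>.\<close>
    show "0 < C * (1 / \<tau> 0 + 1) + 1" using C_nonneg \<tau>_pos[of 0] by (simp add: add_nonneg_pos)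
    show "\<forall>\<^sub>F T in sequentially. norm (\<integral>w. residual owner u (x T w) \<partial>M)
        \<le> (C * (1 / \<tau> 0 + 1) + 1) * norm (?avg T)"
      using eventually_ge_at_top[of 1]
    proof eventually_elim
      case (elim T)
      have avg_nonneg: "0 \<le> ?avg T" by (simp add: sum_nonneg less_imp_le[OF \<tau>_pos])
      have "1 / (real T + 1) \<le> 1 / \<tau> 0 * ?avg T"
        using mult_left_mono[OF avg_ge[OF elim], of "1 / \<tau> 0"] \<tau>_pos[of 0] by simp
      then have "1 / (real T + 1) + ?avg T \<le> (1 / \<tau> 0 + 1) * ?avg T"
        by (simp only: distrib_right mult_1_left add_right_mono)
      then have "C * (1 / (real T + 1) + ?avg T) \<le> C * ((1 / \<tau> 0 + 1) * ?avg T)"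
        using C_nonneg by (rule mult_left_mono)
      moreover have "(\<integral>w. residual owner u (x T w) \<partial>M) \<le> C * (1 / (real T + 1) + ?avg T)"
        using main(2)[of T] by (simp add: field_simps)
      ultimately have "(\<integral>w. residual owner u (x T w) \<partial>M) \<le> (C * (1 / \<tau> 0 + 1) + 1) * ?avg T"
        using avg_nonneg by (simp only: distrib_right mult_1_left mult.assoc)
      moreover have "0 \<le> (\<integral>w. residual owner u (x T w) \<partial>M)" by simp
      ultimately show ?case using avg_nonneg by (simp only: real_norm_def abs_of_nonneg)
    qed
  qed
  \<comment> \<open>The chain gives the first rate, and \<open>slow\<close> refutes the premise of
    the second implication.\<close>
  also note assms(16)
  finally show ?thesis using slow main(1) by simp
qed

end
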